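(* For all positive integers $r$, the following identity of formal power series in $u,t$ (with coefficients rational functions in $q,p,a$) holds: \[ \sum_{n\geq 0}\frac{u^n}{(t;q)_{n+1}\,[\hat n]_{a[r-1]_{ap},p}!}\sum_{\gamma\in G(r,n)} t^{\mathrm{des}_G(\gamma)}q^{\mathrm{maj}(\gamma)}p^{\ell_G(\gamma)}a^{\mathrm{col}(\gamma)} =\sum_{k\geq 0}t^k\prod_{i=0}^{k-1}e[q^{i}u]_{p}\cdot \hat e[q^ku]_{a[r-1]_{ap},p}. \]
   Context: Notation: $(x;p)_0=1$, $(x;p)_n=(1-x)(1-xp)\cdots(1-xp^{n-1})$; $[n]_p=1+p+\dots+p^{n-1}$, $[n]_p!=[n]_p[n-1]_p\cdots[1]_p$, $[0]_p!=1$; $[\hat n]_{x,p}!=(-xp;p)_n[n]_p!$; $e[u]_p=\sum_{n\ge0}u^n/[n]_p!$ and $\hat e[u]_{x,p}=\sum_{n\ge0}u^n/[\hat n]_{x,p}!$. Here $[r-1]_{ap}=1+ap+\dots+(ap)^{r-2}$. $G(r,n)$ is the set of $r$-colored permutations $\gamma=(c_1,\dots,c_n;\sigma)$ with $c_i\in\{0,\dots,r-1\}$ and $\sigma\in S_n$, written in window notation $\gamma=[\gamma(1),\dots,\gamma(n)]=[\sigma(1)^{c_1},\dots,\sigma(n)^{c_n}]$ (exponent $0$ omitted). Colored integers $x^c$ ($x\in\mathbb N$, $c\in\{0,\dots,r-1\}$, $x^0=x$) are totally ordered by: uncolored integers in natural order; every $x^c$ with $c\ge1$ is smaller than every uncolored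 integer (including $0$); for $c,d\ge1$, $x^c<y^d$ iff $x>y$, or $x=y$ and $c>d$ (so $n^{r-1}<\dots<n^1<(n-1)^{r-1}<\dots<1^1<0<1<\dots<n$). $\mathrm{Des}_G(\gamma)=\{i\in\{0,\dots,n-1\}:\gamma(i)>\gamma(i+1)\}$ with $\gamma(0):=0$; $\mathrm{des}_G(\gamma)=|\mathrm{Des}_G(\gamma)|$; $\mathrm{maj}(\gamma)=\sum_{i\in\mathrm{Des}_G(\gamma)}i$; $\mathrm{col}(\gamma)=\sum_i c_i$; $\mathrm{inv}(\gamma)=\#\{(i,j):1\le i<j\le n,\ \gamma(i)>\gamma(j)\}$; and the length is $\ell_G(\gamma)=\mathrm{inv}(\gamma)+\sum_{i:\,c_i\neq0}(\sigma(i)+c_i-1)$. *)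

theory Defs
  imports
    "HOL-Computational_Algebra.Computational_Algebra"
    "HOL-Library.FuncSet"
    "HOL-Combinatorics.Permutations"
begin

section \<open>Rational functions in \<open>q\<close>, \<open>p\<close>, \<open>a\<close>\<close>

text \<open>The field \<open>\<rat>(q,p,a)\<close>: the innermost polynomial indeterminate is \<open>a\<close>, the
  middle one \<open>p\<close>, the outermost one \<open>q\<close>.\<close>

type_synonym ratfun = "rat poly poly poly fract"

definition var_q :: ratfun where "var_q = Fract [:0, 1:] 1"
definition var_p :: ratfun where "var_p = Fract [:[:0, 1:]:] 1"
definition var_a :: ratfun where "var_a = Fract [:[:[:0, 1:]:]:] 1"


section \<open>\<open>q\<close>-analogues\<close>

definition q_poch :: "'a::comm_ring_1 \<Rightarrow> 'a \<Rightarrow> nat \<Rightarrow> 'a" where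
  "q_poch x p n = (\<Prod>i<n. 1 - x * p ^ i)"

definition q_int :: "nat \<Rightarrow> 'a::comm_ring_1 \<Rightarrow> 'a" where
  "q_int n p = (\<Sum>i<n. p ^ i)"

definition q_fact :: "nat \<Rightarrow> 'a::comm_ring_1 \<Rightarrow> 'a" where
  "q_fact n p = (\<Prod>i=1..n. q_int i p)"

definition q_hat_fact :: "nat \<Rightarrow> 'a::comm_ring_1 \<Rightarrow> 'a \<Rightarrow> 'a" where
  "q_hat_fact n x p = q_poch (- (x * p)) p n * q_fact n p"

definition q_exp :: "'a::field \<Rightarrow> 'a fps" where
  "q_exp p = Abs_fps (\<lambda>n. 1 / q_fact n p)"

definition q_hat_exp :: "'a::field \<Rightarrow> 'a \<Rightarrow> 'a fps" where
  "q_hat_exp x p = Abs_fps (\<lambda>n. 1 / q_hat_fact n x p)"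

text \<open>The substitution \<open>f[u] \<mapsto> f[c u]\<close>.\<close>

definition fps_dilate :: "'a::comm_ring_1 fps \<Rightarrow> 'a \<Rightarrow> 'a fps" where
  "fps_dilate f c = fps_compose f (fps_const c * fps_X)"


section \<open>Formal power series in \<open>u\<close> and \<open>t\<close>\<close>

text \<open>Series in \<open>u\<close>, \<open>t\<close> over \<open>'a\<close> are elements of \<open>'a fps fps\<close>, the outer variable being
  \<open>u\<close> and the inner one \<open>t\<close>: \<open>F $ m $ n\<close> is the coefficient of \<open>u^m t^n\<close>.\<close>

definition ps_u :: "'a::comm_ring_1 fps fps" where "ps_u = fps_X"
definition ps_t :: "'a::comm_ring_1 fps fps" where "ps_t = fps_const fps_X"

text \<open>The embeddings of the series in \<open>u\<close> alone and of the series in \<open>t\<close> alone.\<close>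

definition of_u_series :: "'a::comm_ring_1 fps \<Rightarrow> 'a fps fps" where
  "of_u_series f = Abs_fps (\<lambda>m. fps_const (f $ m))"

definition of_t_series :: "'a::comm_ring_1 fps \<Rightarrow> 'a fps fps" where
  "of_t_series f = fps_const f"

text \<open>Infinite sums are formal: every coefficient of the partial sums is eventually constant.
  (The library's metric on \<open>'a fps fps\<close> is adic with respect to the outer variable only, so
  the library's \<open>suminf\<close> is not suitable for a sum over powers of \<open>t\<close>.)\<close>

definition fps2_sums :: "(nat \<Rightarrow> 'a::comm_ring_1 fps fps) \<Rightarrow> 'a fps fps \<Rightarrow> bool" where
  "fps2_sums F S \<longleftrightarrow>
     (\<forall>m n. eventually (\<lambda>N. (\<Sum>i<N. F i) $ m $ n = S $ m $ n) sequentially)"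

definition fps2_suminf :: "(nat \<Rightarrow> 'a::comm_ring_1 fps fps) \<Rightarrow> 'a fps fps" where
  "fps2_suminf F = (THE S. fps2_sums F S)"

lemma fps2_sums_unique:
  assumes "fps2_sums F S" "fps2_sums F S'"
  shows "S = S'"
proof (intro fps_ext)
  fix m n
  have "eventually (\<lambda>N. S $ m $ n = S' $ m $ n) sequentially"
    using assms[unfolded fps2_sums_def, rule_format, of m n]
    by eventually_elim simp
  thus "S $ m $ n = S' $ m $ n" by simp
qed

lemma fps2_suminf_eq: "fps2_sums F S \<Longrightarrow> fps2_suminf F = S"
  unfolding fps2_suminf_def by (blast intro: fps2_sums_unique the_equality)

lemma fps2_sums_locally_finite:
  assumes "\<And>m n i. i > b m n \<Longrightarrow> F i $ m $ n = 0"
  shows "fps2_sums F (Abs_fps (\<lambda>m. Abs_fps (\<lambda>n. \<Sum>i\<le>b m n. F i $ m $ n)))"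
  unfolding fps2_sums_def
proof (intro allI)
  fix m n
  show "eventually (\<lambda>N. (\<Sum>i<N. F i) $ m $ n =
      Abs_fps (\<lambda>m. Abs_fps (\<lambda>n. \<Sum>i\<le>b m n. F i $ m $ n)) $ m $ n) sequentially"
    using eventually_gt_at_top[of "b m n"]
  proof eventually_elim
    case (elim N)
    have "(\<Sum>i<N. F i $ m $ n) = (\<Sum>i\<le>b m n. F i $ m $ n)"
      using elim assms by (intro sum.mono_neutral_right) auto
    thus ?case by (simp add: fps_sum_nth)
  qed
qed

text \<open>Sums over powers of \<open>u\<close> and sums over powers of \<open>t\<close> always converge.\<close>

lemma fps2_summable_u: "\<exists>S. fps2_sums (\<lambda>k. ps_u ^ k * F k) S"
  by (rule exI, rule fps2_sums_locally_finite[where b = "\<lambda>m n. m"])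
    (simp add: ps_u_def fps_X_power_mult_nth)

lemma fps2_summable_t: "\<exists>S. fps2_sums (\<lambda>k. ps_t ^ k * F k) S"
  by (rule exI, rule fps2_sums_locally_finite[where b = "\<lambda>m n. n"])
    (simp add: ps_t_def fps_X_power_mult_nth)


section \<open>Colored permutations\<close>

text \<open>The colored integer \<open>x^c\<close> is the pair \<open>(x, c)\<close>.\<close>

type_synonym colored = "nat \<times> nat"

definition colored_less :: "colored \<Rightarrow> colored \<Rightarrow> bool" where
  "colored_less v w \<longleftrightarrow> (case (v, w) of ((x, c), (y, d)) \<Rightarrow>
     if d = 0 then c \<ge> 1 \<or> x < y
     else c \<ge> 1 \<and> (x > y \<or> (x = y \<and> c > d)))"

text \<open>A colored permutation \<open>(c\<^sub>1,\<dots>,c\<^sub>n; \<sigma>)\<close> is the pair \<open>(c, \<sigma>)\<close>. Since its components are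
  total functions, the statistics carry \<open>n\<close> as an argument.\<close>

type_synonym colored_perm = "(nat \<Rightarrow> nat) \<times> (nat \<Rightarrow> nat)"

definition colored_perms :: "nat \<Rightarrow> nat \<Rightarrow> colored_perm set" where
  "colored_perms r n = ({1..n} \<rightarrow>\<^sub>E {0..<r}) \<times> {\<sigma>. \<sigma> permutes {1..n}}"

definition window :: "colored_perm \<Rightarrow> nat \<Rightarrow> colored" where
  "window \<gamma> i = (if i = 0 then (0, 0) else (snd \<gamma> i, fst \<gamma> i))"

definition Des_G :: "nat \<Rightarrow> colored_perm \<Rightarrow> nat set" where
  "Des_G n \<gamma> = {i\<in>{0..<n}. colored_less (window \<gamma> (i + 1)) (window \<gamma> i)}"

definition des_G :: "nat \<Rightarrow> colored_perm \<Rightarrow> nat" where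
  "des_G n \<gamma> = card (Des_G n \<gamma>)"

definition maj :: "nat \<Rightarrow> colored_perm \<Rightarrow> nat" where
  "maj n \<gamma> = \<Sum>(Des_G n \<gamma>)"

definition col :: "nat \<Rightarrow> colored_perm \<Rightarrow> nat" where
  "col n \<gamma> = (\<Sum>i=1..n. fst \<gamma> i)"

definition inv_G :: "nat \<Rightarrow> colored_perm \<Rightarrow> nat" where
  "inv_G n \<gamma> = card {(i, j). 1 \<le> i \<and> i < j \<and> j \<le> n \<and>
     colored_less (window \<gamma> j) (window \<gamma> i)}"

definition length_G :: "nat \<Rightarrow> colored_perm \<Rightarrow> nat" where
  "length_G n \<gamma> = inv_G n \<gamma> + (\<Sum>i\<in>{i\<in>{1..n}. fst \<gamma> i \<noteq> 0}. snd \<gamma> i + fst \<gamma> i - 1)"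

text \<open>The generating polynomial of the four statistics over \<open>G(r,n)\<close>, as a series in \<open>t\<close>.\<close>

definition colored_gen_poly :: "nat \<Rightarrow> nat \<Rightarrow> 'a::comm_ring_1 \<Rightarrow> 'a \<Rightarrow> 'a \<Rightarrow> 'a fps" where
  "colored_gen_poly r n q p a =
     (\<Sum>\<gamma>\<in>colored_perms r n.
        fps_X ^ des_G n \<gamma> * fps_const (q ^ maj n \<gamma> * p ^ length_G n \<gamma> * a ^ col n \<gamma>))"

end

theory Submission
  imports Defs
begin

text \<open>Expanding \<open>t^des q^maj / (t;q)_{n+1}\<close> turns each colored permutation \<open>\<gamma>\<close> into a sum over chains
  \<open>k = f 0 \<ge> f 1 \<ge> \<dots> \<ge> f n \<ge> 0\<close> that are strict at the descents of \<open>\<gamma>\<close>, weighted by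
  \<open>t^k q^(f 1 + \<dots> + f n)\<close>. A pair \<open>(\<gamma>, f)\<close> amounts to giving every value \<open>v \<in> {1..n}\<close> a block
  \<open>f \<le> k\<close> and a color \<open>c < r\<close>, with \<open>c = 0\<close> in block \<open>k\<close>: sorting the values by decreasing block,
  and inside a block by the colored order, recovers \<open>\<gamma>\<close>. Inserting the largest value multiplies the
  weight by a factor that depends only on the block sizes, so induction on \<open>n\<close> shows that the
  assignments with given block sizes \<open>m 0, \<dots>, m k\<close> have total weight
  \<open>[n^]! / ([m 0]! \<cdots> [m (k-1)]! [(m k)^]!)\<close>.\<close>

section \<open>Chains\<close>

text \<open>The start \<open>m\<close> varies so that induction can peel off the first entry, whose
  value is fixed to \<open>k\<close>.\<close>

definition chains :: "nat \<Rightarrow> nat \<Rightarrow> nat set \<Rightarrow> nat \<Rightarrow> (nat \<Rightarrow> nat) set" where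
  "chains m n D k = {f \<in> {m..n} \<rightarrow>\<^sub>E UNIV. f m = k \<and>
     (\<forall>i\<in>{m..<n}. f (Suc i) + of_bool (i \<in> D) \<le> f i)}"

lemma chains_step:
  assumes "f \<in> chains m n D k" "m \<le> i" "i < n"
  shows "f (Suc i) + of_bool (i \<in> D) \<le> f i"
  using assms unfolding chains_def by simp

lemma chains_le:
  assumes "f \<in> chains m n D k" "m \<le> i" "i \<le> j" "j \<le> n"
  shows "f j \<le> f i"
  using assms(3,2,4)
proof (induction rule: dec_induct)
  case (step l)
  then have "f (Suc l) \<le> f l" using chains_step[OF assms(1), of l] by simp
  with step show ?case by simp
qed simp

lemma finite_chains: "m \<le> n \<Longrightarrow> finite (chains m n D k)"
proof -
  assume "m \<le> n"
  have "chains m n D k \<subseteq> {m..n} \<rightarrow>\<^sub>E {..k}"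
  proof
    fix f assume f: "f \<in> chains m n D k"
    then have "f i \<le> k" if "i \<in> {m..n}" for i
      using chains_le[OF f, of m i] that f by (auto simp: chains_def)
    with f show "f \<in> {m..n} \<rightarrow>\<^sub>E {..k}" by (auto simp: chains_def PiE_iff)
  qed
  then show ?thesis by (rule finite_subset) (auto intro: finite_PiE)
qed

lemma chains_self: "chains n n D k = {\<lambda>i. if i = n then k else undefined}"
  by (auto simp: chains_def fun_eq_iff PiE_iff extensional_def)

lemma chains_rec:
  assumes "m < n"
  shows "chains m n D k = (\<lambda>f. f(m := k)) ` (\<Union>l\<in>{l. l + of_bool (m \<in> D) \<le> k}. chains (Suc m) n D l)"
    (is "_ = ?g ` ?U")
proof (intro equalityI subsetI)
  fix f assume f: "f \<in> chains m n D k"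
  \<comment> \<open>Peeling off the entry at \<open>m\<close> has to restore the default value
    there, since tails are extensional on \<open>{Suc m..n}\<close>.\<close>
  define h where "h = f(m := undefined)"
  have "f = h(m := k)" using f by (auto simp: h_def chains_def)
  moreover have "h \<in> chains (Suc m) n D (f (Suc m))"
    using f by (auto simp: h_def chains_def PiE_iff extensional_def)
  moreover have "f (Suc m) + of_bool (m \<in> D) \<le> k"
    using chains_step[OF f order_refl assms] f by (simp add: chains_def)
  ultimately show "f \<in> ?g ` ?U" by blast
next
  fix f assume "f \<in> ?g ` ?U"
  then obtain h l where f: "f = h(m := k)" and l: "l + of_bool (m \<in> D) \<le> k"
    and h: "h \<in> chains (Suc m) n D l" by blast
  have "f (Suc i) + of_bool (i \<in> D) \<le> f i" if "i \<in> {m..<n}" for i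
  proof (cases "i = m")
    case True then show ?thesis using h l by (simp add: f chains_def)
  next
    case False then show ?thesis using h that by (simp add: f chains_def)
  qed
  then show "f \<in> chains m n D k"
    using h assms by (auto simp: f chains_def PiE_iff extensional_def)
qed

text \<open>The exponent leaves out the first entry \<open>f m = k\<close>; that value is recorded
  later by the power of \<open>t\<close>.\<close>

definition chain_poly :: "nat \<Rightarrow> nat \<Rightarrow> nat set \<Rightarrow> 'a::comm_ring_1 \<Rightarrow> nat \<Rightarrow> 'a" where
  "chain_poly m n D q k = (\<Sum>f\<in>chains m n D k. q ^ (\<Sum>i\<in>{m<..n}. f i))"

lemma chain_poly_rec:
  assumes "m < n"
  shows "chain_poly m n D q k =
    (\<Sum>l | l + of_bool (m \<in> D) \<le> k. q ^ l * chain_poly (Suc m) n D q l)"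
proof -
  let ?L = "{l. l + of_bool (m \<in> D) \<le> k}"
  have finL: "finite ?L" by (rule finite_subset[of _ "{..k}"]) auto
  \<comment> \<open>Chains from \<open>Suc m\<close> are \<open>undefined\<close> at
    \<open>m\<close>, so overwriting that entry loses no information.\<close>
  have inj: "inj_on (\<lambda>f. f(m := k)) (\<Union>l\<in>?L. chains (Suc m) n D l)"
  proof (rule inj_onI)
    fix f h assume fh: "f \<in> (\<Union>l\<in>?L. chains (Suc m) n D l)" "h \<in> (\<Union>l\<in>?L. chains (Suc m) n D l)"
      and e: "f(m := k) = h(m := k)"
    have "f m = h m" using fh by (auto simp: chains_def PiE_iff extensional_def)
    moreover have "f i = h i" if "i \<noteq> m" for i using fun_cong[OF e, of i] that by simp
    ultimately show "f = h" by (intro ext) metis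
  qed
  have "chain_poly m n D q k =
      (\<Sum>f\<in>(\<Union>l\<in>?L. chains (Suc m) n D l). q ^ (\<Sum>i\<in>{m<..n}. f i))"
    unfolding chain_poly_def chains_rec[OF assms]
    by (subst sum.reindex[OF inj]) (auto intro!: sum.cong arg_cong[where f = "\<lambda>e. q ^ e"])
  also have "\<dots> = (\<Sum>l\<in>?L. \<Sum>f\<in>chains (Suc m) n D l. q ^ (\<Sum>i\<in>{m<..n}. f i))"
  proof (rule sum.UNION_disjoint[OF finL])
    show "\<forall>i\<in>?L. finite (chains (Suc m) n D i)" using assms by (auto intro: finite_chains)
  qed (auto simp: chains_def)
  also have "\<dots> = (\<Sum>l\<in>?L. q ^ l * chain_poly (Suc m) n D q l)"
  proof (rule sum.cong[OF refl])
    fix l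
    have "{m<..n} = insert (Suc m) {Suc m<..n}" using assms by auto
    then show "(\<Sum>f\<in>chains (Suc m) n D l. q ^ (\<Sum>i\<in>{m<..n}. f i)) =
        q ^ l * chain_poly (Suc m) n D q l"
      by (auto simp: chain_poly_def sum_distrib_left power_add chains_def intro!: sum.cong)
  qed
  finally show ?thesis .
qed

section \<open>Dilation of series and the generating function of the chains\<close>

lemma fps_dilate_nth [simp]: "fps_dilate f c $ n = c ^ n * f $ n"
  by (simp add: fps_dilate_def fps_compose_linear)

lemma fps_dilate_mult: "fps_dilate (f * g) (c :: 'a::idom) = fps_dilate f c * fps_dilate g c"
  by (simp add: fps_dilate_def fps_compose_mult_distrib)

lemma fps_dilate_X_power: "fps_dilate (fps_X ^ m) c = fps_const (c ^ m) * fps_X ^ m"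
  by (simp add: fps_eq_iff)

lemma fps_dilate_const: "fps_dilate (fps_const d) c = fps_const d"
  by (auto simp: fps_eq_iff)

lemma fps_dilate_q_poch_X:
  fixes q :: "'a::idom"
  shows "fps_dilate (q_poch fps_X (fps_const q) n) q = q_poch (fps_const q * fps_X) (fps_const q) n"
proof -
  have "fps_dilate (1 - fps_X * fps_const q ^ i) q = 1 - fps_const q * fps_X * fps_const q ^ i" for i
    by (auto simp: fps_eq_iff fps_const_power fps_mult_right_const_nth le_Suc_eq)
  then show ?thesis
    by (simp add: q_poch_def fps_dilate_def fps_compose_prod_distrib)
qed

lemma q_poch_Suc_left: "q_poch x p (Suc n) = (1 - x) * q_poch (p * x) p n"
  by (simp add: q_poch_def prod.lessThan_Suc_shift mult_ac del: prod.lessThan_Suc)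

lemma one_minus_X_times_nth:
  "((1 - fps_X) * f) $ k = (f :: 'a::comm_ring_1 fps) $ k - (if k = 0 then 0 else f $ (k - 1))"
  by (simp add: left_diff_distrib)

text \<open>Multiplication by \<open>1 - fps_X\<close> takes differences in \<open>k\<close> and so
  collapses the sum of \<open>chain_poly_rec\<close> to its last term. This is the series for
  \<open>Suc m\<close> with \<open>t\<close> replaced by \<open>q t\<close>, times \<open>t\<close>
  if \<open>m \<in> D\<close>. The replacement shifts the Pochhammer product of the tail to the
  factors still missing, so the induction runs downwards from \<open>m = n\<close>. At
  \<open>m = 0\<close> and \<open>D = Des_G n \<gamma>\<close> the right-hand side is t^des
  q^maj.\<close>

lemma chain_gf:
  fixes q :: "'a::field"
  assumes "m \<le> n"
  shows "q_poch fps_X (fps_const q) (Suc (n - m)) * Abs_fps (chain_poly m n D q) =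
    fps_X ^ card (D \<inter> {m..<n}) * fps_const (q ^ (\<Sum>i\<in>D \<inter> {m..<n}. i - m))"
  using assms
proof (induction rule: inc_induct)
  case base
  have "chain_poly n n D q = (\<lambda>_. 1)"
    by (simp add: fun_eq_iff chain_poly_def chains_self)
  then show ?case
    by (auto simp: q_poch_def fps_eq_iff one_minus_X_times_nth)
next
  case (step m)
  let ?b = "of_bool (m \<in> D) :: nat"
  let ?G = "Abs_fps (chain_poly (Suc m) n D q)"
  have "(1 - fps_X) * Abs_fps (chain_poly m n D q) = fps_X ^ ?b * fps_dilate ?G q"
  proof (rule fps_ext)
    fix k
    have rec: "chain_poly m n D q k =
        (\<Sum>l | l + ?b \<le> k. q ^ l * chain_poly (Suc m) n D q l)" for k
      using step by (intro chain_poly_rec)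
    have "{l. l \<le> k} = insert k {..<k}" "{l. Suc l \<le> k} = {..<k}" for k by auto
    then show "((1 - fps_X) * Abs_fps (chain_poly m n D q)) $ k = (fps_X ^ ?b * fps_dilate ?G q) $ k"
      by (cases k) (auto simp: one_minus_X_times_nth rec)
  qed
  then have "q_poch (fps_const q * fps_X) (fps_const q) (Suc (n - Suc m)) *
        ((1 - fps_X) * Abs_fps (chain_poly m n D q)) =
      fps_X ^ ?b * (q_poch (fps_const q * fps_X) (fps_const q) (Suc (n - Suc m)) * fps_dilate ?G q)"
    by (simp only: mult.left_commute)
  moreover have "Suc (n - m) = Suc (Suc (n - Suc m))" using step by simp
  ultimately have "q_poch fps_X (fps_const q) (Suc (n - m)) * Abs_fps (chain_poly m n D q) =
      fps_X ^ ?b * (q_poch (fps_const q * fps_X) (fps_const q) (Suc (n - Suc m)) * fps_dilate ?G q)"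
    by (simp only: q_poch_Suc_left[of _ _ "Suc (n - Suc m)"] mult.assoc mult.left_commute[of "1 - fps_X"])
  also have "\<dots> = fps_X ^ ?b * fps_dilate
      (fps_X ^ card (D \<inter> {Suc m..<n}) * fps_const (q ^ (\<Sum>i\<in>D \<inter> {Suc m..<n}. i - Suc m))) q"
    by (simp only: step.IH[symmetric] fps_dilate_mult fps_dilate_q_poch_X)
  also have "\<dots> = fps_X ^ (?b + card (D \<inter> {Suc m..<n})) *
      fps_const (q ^ (card (D \<inter> {Suc m..<n}) + (\<Sum>i\<in>D \<inter> {Suc m..<n}. i - Suc m)))"
    by (simp add: fps_dilate_mult fps_dilate_X_power fps_dilate_const power_add mult_ac
        flip: fps_const_mult)
  \<comment> \<open>Dilating the power of \<open>fps_X\<close> yields one factor \<open>q\<close>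
    for each element of \<open>D\<close> beyond \<open>m\<close>, which raises every
    \<open>i - Suc m\<close> to \<open>i - m\<close>.\<close>
  also have "card (D \<inter> {Suc m..<n}) + (\<Sum>i\<in>D \<inter> {Suc m..<n}. i - Suc m) =
      (\<Sum>i\<in>D \<inter> {Suc m..<n}. i - m)"
    by (subst card_eq_sum, subst sum.distrib[symmetric]) (auto intro!: sum.cong)
  \<comment> \<open>The index \<open>m\<close> may join the sum because its term
    \<open>m - m\<close> vanishes.\<close>
  also have "(\<Sum>i\<in>D \<inter> {Suc m..<n}. i - m) = (\<Sum>i\<in>D \<inter> {m..<n}. i - m)"
    by (rule sum.mono_neutral_left) (auto simp: le_Suc_eq not_less_eq_eq)
  also have "?b + card (D \<inter> {Suc m..<n}) = card (D \<inter> {m..<n})"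
  proof -
    have "{m..<n} = insert m {Suc m..<n}" using step by auto
    then show ?thesis by (cases "m \<in> D") auto
  qed
  finally show ?case .
qed

section \<open>Block assignments\<close>

lemma q_fact_Suc: "q_fact (Suc n) p = q_fact n p * q_int (Suc n) p"
  by (simp add: q_fact_def)

lemma q_hat_fact_Suc:
  "q_hat_fact (Suc n) x p = q_hat_fact n x p * ((1 + x * p ^ Suc n) * q_int (Suc n) p)"
  by (simp add: q_hat_fact_def q_fact_Suc q_poch_def mult_ac)

lemma q_int_add: "q_int (i + j) p = q_int i p + p ^ i * q_int j p"
proof -
  have "{..<i + j} = {..<i} \<union> {i..<i + j}" by auto
  then have "q_int (i + j) p = q_int i p + (\<Sum>l\<in>{i..<i + j}. p ^ l)"
    by (simp add: q_int_def sum.union_disjoint ivl_disj_int)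
  also have "(\<Sum>l\<in>{i..<i + j}. p ^ l) = p ^ i * q_int j p"
    using sum.shift_bounds_nat_ivl[of "\<lambda>l. p ^ l" 0 i j]
    by (simp add: q_int_def sum_distrib_left atLeast0LessThan power_add add.commute mult.commute)
  finally show ?thesis .
qed

text \<open>The exponents of the total are cut into consecutive runs, one per block; the run of
  block \<open>f\<close> starts after those of all smaller blocks.\<close>

lemma q_int_sum_below:
  fixes m :: "nat \<Rightarrow> nat"
  shows "(\<Sum>f<K. q_int (m f) p * p ^ (\<Sum>i<f. m i)) = q_int (\<Sum>i<K. m i) p"
  by (induction K) (simp_all add: q_int_add mult.commute, simp add: q_int_def)

text \<open>The same cutting with the blocks laid out from the top down, so that a new block
  \<open>K\<close> goes in front and shifts all the others.\<close>

lemma q_int_sum_above: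
  fixes m :: "nat \<Rightarrow> nat"
  shows "(\<Sum>f<K. q_int (m f) p * p ^ (\<Sum>i\<in>{f<..<K}. m i)) = q_int (\<Sum>i<K. m i) p"
proof (induction K)
  case (Suc K)
  have "{f<..<Suc K} = insert K {f<..<K}" if "f < K" for f using that by auto
  then have "(\<Sum>f<K. q_int (m f) p * p ^ (\<Sum>i\<in>{f<..<Suc K}. m i)) =
      p ^ m K * (\<Sum>f<K. q_int (m f) p * p ^ (\<Sum>i\<in>{f<..<K}. m i))"
    by (simp add: sum_distrib_left power_add mult_ac)
  moreover have "{K<..<Suc K} = {}" by auto
  ultimately show ?case
    using Suc by (simp add: q_int_add[of "m K"] add.commute)
qed (simp add: q_int_def)

lemma size_filter_mset_eq_sum:
  assumes "finite A" "\<And>i. i \<in># M \<Longrightarrow> P i \<longleftrightarrow> i \<in> A"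
  shows "size (filter_mset P M) = (\<Sum>i\<in>A. count M i)"
proof -
  have "filter_mset P M = filter_mset (\<lambda>i. i \<in> A) M"
    using assms(2) by (intro filter_mset_cong) auto
  also have "size \<dots> = (\<Sum>i\<in>set_mset M \<inter> A. count M i)"
    by (auto simp: size_multiset_overloaded_eq intro!: sum.cong)
  also have "\<dots> = (\<Sum>i\<in>A. count M i)"
    using assms(1) by (intro sum.mono_neutral_left) (auto simp: not_in_iff)
  finally show ?thesis .
qed

section \<open>Multinomial coefficients with one hatted block\<close>

definition block_fact :: "nat \<Rightarrow> 'a::comm_ring_1 \<Rightarrow> 'a \<Rightarrow> nat \<Rightarrow> nat \<Rightarrow> 'a" where
  "block_fact k x p i j = (if i < k then q_fact j p else q_hat_fact j x p)"

text \<open>For \<open>x = 0\<close> this is the Gaussian multinomial coefficient in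
  \<open>p\<close>. Block \<open>k\<close> has the hatted factorial because its values carry no
  color.\<close>

definition hat_multinom :: "nat \<Rightarrow> 'a::field \<Rightarrow> 'a \<Rightarrow> nat multiset \<Rightarrow> 'a" where
  "hat_multinom k x p M = q_hat_fact (size M) x p / (\<Prod>i\<le>k. block_fact k x p i (count M i))"

text \<open>The factor contributed by inserting a new largest value into block \<open>f\<close>, summed over its colors:
  uncolored it is inverted with the values of the blocks below, colored with those of the blocks
  above.\<close>

definition insert_weight :: "nat \<Rightarrow> 'a::comm_ring_1 \<Rightarrow> 'a \<Rightarrow> nat \<Rightarrow> nat multiset \<Rightarrow> 'a" where
  "insert_weight k x p f M = p ^ size (filter_mset (\<lambda>i. i < f) M) +
     (if f < k then x * p ^ Suc (size M) * p ^ size (filter_mset (\<lambda>i. f < i) M) else 0)"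

text \<open>Here \<open>M\<close> already contains the new value. The uncolored terms add up to the
  \<open>q_int\<close> of the total size, and the colored ones to \<open>x * p ^ size M\<close>
  times the same, except that block \<open>k\<close> is missing. The extra factor
  \<open>1 + x * p ^ count M k\<close> supplies exactly the missing term, since
  \<open>p ^ count M k\<close> times the power for the blocks below \<open>k\<close> is
  \<open>p ^ size M\<close>.\<close>

lemma insert_weight_sum:
  assumes "set_mset M \<subseteq> {..k}"
  shows "(\<Sum>f\<le>k. q_int (count M f) p * (if f < k then 1 else 1 + x * p ^ count M k) *
            insert_weight k x p f (M - {#f#})) =
         (1 + x * p ^ size M) * q_int (size M) p"
proof -
  let ?b = "\<lambda>f. p ^ (\<Sum>i<f. count M i)" and ?t = "\<lambda>f. p ^ (\<Sum>i\<in>{f<..<Suc k}. count M i)"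
  have size_M: "size M = (\<Sum>i<Suc k. count M i)"
    using size_filter_mset_eq_sum[of "{..<Suc k}" M "\<lambda>_. True"] assms by (auto simp: less_Suc_eq_le)
  \<comment> \<open>Removing one \<open>f\<close> changes no block below or above \<open>f\<close>.
    If \<open>f\<close> does not occur in \<open>M\<close>, nothing is removed and the insertion
    weight is off, but then \<open>q_int 0 p = 0\<close> annihilates both sides.\<close>
  have ins: "q_int (count M f) p * insert_weight k x p f (M - {#f#}) =
      q_int (count M f) p * (?b f + (if f < k then x * p ^ size M * ?t f else 0))" for f
  proof (cases "f \<in># M")
    case True
    then obtain N where M: "M = add_mset f N" by (metis mset_add)
    have "size (filter_mset (\<lambda>i. i < f) M) = (\<Sum>i<f. count M i)"
      by (rule size_filter_mset_eq_sum) auto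
    moreover have "size (filter_mset (\<lambda>i. f < i) M) = (\<Sum>i\<in>{f<..<Suc k}. count M i)"
      using assms by (intro size_filter_mset_eq_sum) (auto simp: less_Suc_eq_le)
    ultimately show ?thesis
      by (simp add: insert_weight_def M)
  next
    case False
    then show ?thesis by (simp add: not_in_iff q_int_def)
  qed
  have "(\<Sum>f\<le>k. q_int (count M f) p * (if f < k then 1 else 1 + x * p ^ count M k) *
            insert_weight k x p f (M - {#f#})) =
      (\<Sum>f<Suc k. (if f < k then 1 else 1 + x * p ^ count M k) *
        (q_int (count M f) p * (?b f + (if f < k then x * p ^ size M * ?t f else 0))))"
    by (intro sum.cong) (auto simp: ins[symmetric] mult_ac)
  also have "\<dots> = (\<Sum>f<Suc k. q_int (count M f) p * ?b f) +
      x * p ^ size M * (\<Sum>f<k. q_int (count M f) p * ?t f) +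
      x * p ^ count M k * q_int (count M k) p * ?b k"
    by (simp add: ring_distribs sum.distrib sum_distrib_left mult_ac)
  also have "(\<Sum>f<k. q_int (count M f) p * ?t f) =
      (\<Sum>f<Suc k. q_int (count M f) p * ?t f) - q_int (count M k) p"
  proof -
    have "{k<..<Suc k} = {}" by auto
    then show ?thesis by simp
  qed
  also have "p ^ size M = p ^ count M k * ?b k"
    by (simp add: size_M power_add mult.commute)
  finally show ?thesis
    by (simp only: q_int_sum_below q_int_sum_above size_M[symmetric])
      (simp add: algebra_simps size_M power_add)
qed

text \<open>A Pascal-type recurrence by the block of the last inserted value. Deleting
  \<open>f\<close> multiplies the coefficient by \<open>?\<rho> f / c\<close>, where
  \<open>?\<rho> f\<close> is the quotient of successive factorials of block \<open>f\<close> and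
  \<open>c\<close> that of the total; \<open>insert_weight_sum\<close> says that the weighted
  \<open>?\<rho> f\<close> add up to \<open>c\<close>.\<close>

lemma hat_multinom_rec:
  fixes p x :: "'a::field"
  assumes nz: "\<And>j. q_hat_fact j x p \<noteq> 0"
    and M: "set_mset M \<subseteq> {..k}" "size M = Suc n"
  shows "(\<Sum>f\<in>set_mset M. hat_multinom k x p (M - {#f#}) * insert_weight k x p f (M - {#f#})) =
    hat_multinom k x p M"
proof -
  have nz': "q_fact j p \<noteq> 0" for j using nz[of j] by (auto simp: q_hat_fact_def)
  have bnz: "block_fact k x p i j \<noteq> 0" for i j by (simp add: block_fact_def nz nz')
  define c where "c = (1 + x * p ^ Suc n) * q_int (Suc n) p"
  have c: "q_hat_fact (Suc n) x p = q_hat_fact n x p * c"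
    by (simp add: c_def q_hat_fact_Suc)
  have "c \<noteq> 0" using nz[of "Suc n"] c by auto
  let ?\<rho> = "\<lambda>f. q_int (count M f) p * (if f < k then 1 else 1 + x * p ^ count M k)"
  have rec: "hat_multinom k x p (M - {#f#}) = hat_multinom k x p M / c * ?\<rho> f" if f: "f \<in># M" for f
  proof -
    obtain j where j: "count M f = Suc j" using f by (metis count_greater_zero_iff gr0_implies_Suc)
    have fk: "f \<in> {..k}" using f M by auto
    have "block_fact k x p f (Suc j) = block_fact k x p f j * ?\<rho> f"
      using j fk by (auto simp: block_fact_def q_hat_fact_Suc q_fact_Suc le_less)
    moreover from this have "?\<rho> f \<noteq> 0" using bnz[of f "Suc j"] by auto
    moreover have "(\<Prod>i\<in>{..k} - {f}. block_fact k x p i (count (M - {#f#}) i)) =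
        (\<Prod>i\<in>{..k} - {f}. block_fact k x p i (count M i))"
      by (intro prod.cong) auto
    ultimately show ?thesis
      using \<open>c \<noteq> 0\<close> f M(2) j nz[of n]
      by (simp add: hat_multinom_def prod.remove[OF _ fk] size_Diff_singleton c bnz)
  qed
  have "(\<Sum>f\<in>set_mset M. hat_multinom k x p (M - {#f#}) * insert_weight k x p f (M - {#f#})) =
      (\<Sum>f\<in>set_mset M. hat_multinom k x p M / c * (?\<rho> f * insert_weight k x p f (M - {#f#})))"
    by (intro sum.cong refl) (simp add: rec)
  \<comment> \<open>Blocks that do not occur in \<open>M\<close> may be added, as
    \<open>?\<rho>\<close> vanishes there.\<close>
  also have "\<dots> = (\<Sum>f\<le>k. hat_multinom k x p M / c * (?\<rho> f * insert_weight k x p f (M - {#f#})))"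
    using M by (intro sum.mono_neutral_left) (auto simp: not_in_iff q_int_def)
  also have "\<dots> = hat_multinom k x p M"
    using insert_weight_sum[OF M(1), of p x] \<open>c \<noteq> 0\<close> M(2)
    by (simp only: sum_distrib_left[symmetric] c_def[symmetric]) simp
  finally show ?thesis .
qed

text \<open>A colored value in block \<open>k\<close> would bring a colored value to the first
  position, making \<open>0\<close> a descent and forcing \<open>f 1 < k\<close>. Hence block
  \<open>k\<close> admits only color \<open>0\<close>.\<close>

definition letters :: "nat \<Rightarrow> nat \<Rightarrow> (nat \<times> nat) set" where
  "letters r k = {(f, c). f \<le> k \<and> c < r \<and> (f = k \<longrightarrow> c = 0)}"

text \<open>An assignment maps a value \<open>v\<close> to its pair (block, color).\<close>

definition assignments :: "nat \<Rightarrow> nat \<Rightarrow> nat \<Rightarrow> (nat \<Rightarrow> nat \<times> nat) set" where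
  "assignments r k n = {1..n} \<rightarrow>\<^sub>E letters r k"

definition blocks :: "nat \<Rightarrow> (nat \<Rightarrow> nat \<times> nat) \<Rightarrow> nat multiset" where
  "blocks n g = image_mset (\<lambda>v. fst (g v)) (mset_set {1..n})"

text \<open>Pairs of values, not of positions. Inside a block the values get sorted increasingly, so
  only pairs from different blocks can be inverted, and the higher block stands first.\<close>

definition assignment_invs :: "nat \<Rightarrow> (nat \<Rightarrow> nat \<times> nat) \<Rightarrow> (nat \<times> nat) set" where
  "assignment_invs n g = {(v, w) \<in> {1..n} \<times> {1..n}.
     fst (g w) < fst (g v) \<and> colored_less (w, snd (g w)) (v, snd (g v))}"

definition assignment_length :: "nat \<Rightarrow> (nat \<Rightarrow> nat \<times> nat) \<Rightarrow> nat" where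
  "assignment_length n g = card (assignment_invs n g) +
     (\<Sum>v\<in>{v\<in>{1..n}. snd (g v) \<noteq> 0}. v + snd (g v) - 1)"

section \<open>Insertion of the largest value\<close>

lemma finite_assignment_invs: "finite (assignment_invs n g)"
  by (rule finite_subset[of _ "{1..n} \<times> {1..n}"]) (auto simp: assignment_invs_def)

lemma atLeastAtMost_1_Suc: "{1..Suc n} = insert (Suc n) {1..n}"
  by auto

lemma size_filter_blocks: "size (filter_mset P (blocks n g)) = card {v\<in>{1..n}. P (fst (g v))}"
  by (simp add: blocks_def filter_mset_image_mset filter_mset_mset_set)

lemma blocks_upd: "blocks (Suc n) (g(Suc n := l)) = add_mset (fst l) (blocks n g)"
  unfolding blocks_def atLeastAtMost_1_Suc
  by (auto intro!: image_mset_cong)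

lemma size_blocks: "size (blocks n g) = n"
  by (simp add: blocks_def)

text \<open>Whatever the colors of the smaller values, \<open>Suc n\<close> exceeds all of them if
  uncolored and lies below all of them if colored. So it is inverted with everything after its
  block, or with everything before it.\<close>

lemma card_assignment_invs_upd:
  "card (assignment_invs (Suc n) (g(Suc n := (f, c)))) = card (assignment_invs n g) +
     (if c = 0 then size (filter_mset (\<lambda>i. i < f) (blocks n g))
      else size (filter_mset (\<lambda>i. f < i) (blocks n g)))"
proof -
  let ?B = "{v\<in>{1..n}. fst (g v) < f}" and ?A = "{v\<in>{1..n}. f < fst (g v)}"
  let ?E = "if c = 0 then Pair (Suc n) ` ?B else (\<lambda>v. (v, Suc n)) ` ?A"
  have "assignment_invs (Suc n) (g(Suc n := (f, c))) = assignment_invs n g \<union> ?E"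
  proof (rule set_eqI, clarify)
    fix v w
    consider "v = Suc n" "w = Suc n" | "v = Suc n" "w \<noteq> Suc n" | "v \<noteq> Suc n" "w = Suc n"
      | "v \<noteq> Suc n" "w \<noteq> Suc n" by blast
    then show "((v, w) \<in> assignment_invs (Suc n) (g(Suc n := (f, c)))) =
        ((v, w) \<in> assignment_invs n g \<union> ?E)"
      by cases (auto simp: assignment_invs_def colored_less_def le_Suc_eq split: if_splits)
  qed
  moreover have "assignment_invs n g \<inter> ?E = {}"
    by (auto simp: assignment_invs_def)
  moreover have "card ?E = (if c = 0 then card ?B else card ?A)"
    by (simp add: card_image inj_on_def)
  ultimately show ?thesis
    by (simp add: card_Un_disjoint finite_assignment_invs size_filter_blocks)
qed

lemma assignment_length_upd:
  "assignment_length (Suc n) (g(Suc n := (f, c))) = assignment_length n g +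
     (if c = 0 then size (filter_mset (\<lambda>i. i < f) (blocks n g))
      else size (filter_mset (\<lambda>i. f < i) (blocks n g)) + n + c)"
proof -
  have "{v\<in>{1..Suc n}. snd ((g(Suc n := (f, c))) v) \<noteq> 0} =
      (if c = 0 then {} else {Suc n}) \<union> {v\<in>{1..n}. snd (g v) \<noteq> 0}"
    by (auto simp: le_Suc_eq)
  moreover have "(\<Sum>v\<in>{v\<in>{1..n}. snd (g v) \<noteq> 0}. v + snd ((g(Suc n := (f, c))) v) - 1) =
      (\<Sum>v\<in>{v\<in>{1..n}. snd (g v) \<noteq> 0}. v + snd (g v) - 1)"
    by (intro sum.cong) auto
  ultimately show ?thesis
    unfolding assignment_length_def card_assignment_invs_upd by auto
qed

definition assignment_weight ::
    "'a::comm_ring_1 \<Rightarrow> 'a \<Rightarrow> nat \<Rightarrow> (nat \<Rightarrow> nat \<times> nat) \<Rightarrow> 'a" where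
  "assignment_weight p a n g = p ^ assignment_length n g * a ^ (\<Sum>v=1..n. snd (g v))"

text \<open>This is the origin of \<open>x\<close>: at a fixed block the nonzero colors contribute
  the geometric sum of \<open>p ^ (n + c) * a ^ c\<close> over \<open>1 \<le> c < r\<close>, which
  equals \<open>a * q_int (r - 1) (a * p) * p ^ Suc n\<close>.\<close>

lemma assignment_weight_upd_sum:
  assumes "r \<ge> 1"
  shows "(\<Sum>l\<in>letters r k. assignment_weight p a (Suc n) (g(Suc n := l)) * \<phi> (fst l)) =
    assignment_weight p a n g *
      (\<Sum>f\<le>k. insert_weight k (a * q_int (r - 1) (a * p)) p f (blocks n g) * \<phi> f)"
proof -
  let ?b = "\<lambda>f. p ^ size (filter_mset (\<lambda>i. i < f) (blocks n g))"
  let ?t = "\<lambda>f. p ^ size (filter_mset (\<lambda>i. f < i) (blocks n g))"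
  have wt: "assignment_weight p a (Suc n) (g(Suc n := (f, c))) = assignment_weight p a n g *
      (if c = 0 then ?b f else ?t f * p ^ (n + c) * a ^ c)" for f c
  proof -
    have "(\<Sum>v=1..n. snd ((g(Suc n := (f, c))) v)) = (\<Sum>v=1..n. snd (g v))"
      by (intro sum.cong) auto
    then show ?thesis
      by (simp add: assignment_weight_def assignment_length_upd power_add mult_ac)
  qed
  have "letters r k = (SIGMA f:{..k}. if f < k then {..<r} else {0})"
    using assms by (auto simp: letters_def split: if_splits)
  then have "(\<Sum>l\<in>letters r k. assignment_weight p a (Suc n) (g(Suc n := l)) * \<phi> (fst l)) =
      (\<Sum>f\<le>k. \<Sum>c\<in>(if f < k then {..<r} else {0}).
        assignment_weight p a (Suc n) (g(Suc n := (f, c))) * \<phi> f)"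
    by (simp add: sum.Sigma split_def)
  also have "\<dots> = (\<Sum>f\<le>k. assignment_weight p a n g *
      (insert_weight k (a * q_int (r - 1) (a * p)) p f (blocks n g) * \<phi> f))"
  proof (rule sum.cong[OF refl])
    fix f
    obtain r' where r: "r = Suc r'" using assms by (cases r) auto
    have "(\<Sum>c<r. if c = 0 then ?b f else ?t f * p ^ (n + c) * a ^ c) =
        ?b f + (\<Sum>c<r'. ?t f * p ^ (n + Suc c) * a ^ Suc c)"
      unfolding r by (subst sum.lessThan_Suc_shift) simp
    also have "(\<Sum>c<r'. ?t f * p ^ (n + Suc c) * a ^ Suc c) =
        a * q_int (r - 1) (a * p) * p ^ Suc n * ?t f"
      by (simp add: r q_int_def sum_distrib_left sum_distrib_right power_add power_mult_distrib mult_ac)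
    finally show "(\<Sum>c\<in>(if f < k then {..<r} else {0}).
        assignment_weight p a (Suc n) (g(Suc n := (f, c))) * \<phi> f) = assignment_weight p a n g *
      (insert_weight k (a * q_int (r - 1) (a * p)) p f (blocks n g) * \<phi> f)"
      by (simp add: wt insert_weight_def size_blocks mult.assoc flip: sum_distrib_left sum_distrib_right)
  qed
  finally show ?thesis by (simp add: sum_distrib_left)
qed

lemma sum_assignments_Suc:
  "(\<Sum>g\<in>assignments r k (Suc n). F g) = (\<Sum>g\<in>assignments r k n. \<Sum>l\<in>letters r k. F (g(Suc n := l)))"
proof -
  have "inj_on (\<lambda>(l, g). g(Suc n := l)) (letters r k \<times> assignments r k n)"
    unfolding assignments_def by (rule inj_combinator) simp
  moreover have "assignments r k (Suc n) = (\<lambda>(l, g). g(Suc n := l)) ` (letters r k \<times> assignments r k n)"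
    unfolding assignments_def atLeastAtMost_1_Suc PiE_insert_eq ..
  ultimately have "(\<Sum>g\<in>assignments r k (Suc n). F g) =
      (\<Sum>(l, g)\<in>letters r k \<times> assignments r k n. F (g(Suc n := l)))"
    by (simp add: sum.reindex split_def)
  also have "\<dots> = (\<Sum>l\<in>letters r k. \<Sum>g\<in>assignments r k n. F (g(Suc n := l)))"
    by (rule sum.cartesian_product[symmetric])
  finally show ?thesis by (subst sum.swap)
qed

text \<open>Adding \<open>f\<close> and marking it is inverse to deleting a marked element.\<close>

lemma sum_multisets_Suc:
  assumes "finite A"
  shows "(\<Sum>M\<in>multisets_of_size A n. \<Sum>f\<in>A. F f M) =
    (\<Sum>M\<in>multisets_of_size A (Suc n). \<Sum>f\<in>set_mset M. F f (M - {#f#}))"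
proof -
  have "(\<Sum>(M, f)\<in>multisets_of_size A n \<times> A. F f M) =
      (\<Sum>(M, f)\<in>(SIGMA M:multisets_of_size A (Suc n). set_mset M). F f (M - {#f#}))"
    by (rule sum.reindex_bij_witness
          [where i = "\<lambda>(M, f). (M - {#f#}, f)" and j = "\<lambda>(M, f). (add_mset f M, f)"])
      (auto simp: multisets_of_size_def size_Diff_singleton dest: in_diffD)
  then show ?thesis using assms
    by (simp add: sum.cartesian_product sum.Sigma finite_multisets_of_size split_def)
qed

text \<open>The test function \<open>\<phi>\<close> replaces a sum over the assignments with prescribed block sizes, so that
  the induction needs no fibres.\<close>

lemma sum_assignments:
  fixes p a :: "'a::field" and \<phi> :: "nat multiset \<Rightarrow> 'a"
  assumes "r \<ge> 1"
  defines "x \<equiv> a * q_int (r - 1) (a * p)"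
  assumes nz: "\<And>j. q_hat_fact j x p \<noteq> 0"
  shows "(\<Sum>g\<in>assignments r k n. assignment_weight p a n g * \<phi> (blocks n g)) =
    (\<Sum>M\<in>multisets_of_size {..k} n. hat_multinom k x p M * \<phi> M)"
proof (induction n arbitrary: \<phi>)
  case 0
  have "(\<Prod>i\<le>k. block_fact k x p i 0) = 1"
    by (rule prod.neutral) (simp add: block_fact_def q_fact_def q_hat_fact_def q_poch_def)
  then show ?case
    by (simp add: assignments_def assignment_weight_def assignment_length_def assignment_invs_def
        blocks_def hat_multinom_def q_fact_def q_hat_fact_def q_poch_def)
next
  case (Suc n)
  have "(\<Sum>g\<in>assignments r k (Suc n). assignment_weight p a (Suc n) g * \<phi> (blocks (Suc n) g)) =
      (\<Sum>g\<in>assignments r k n. \<Sum>l\<in>letters r k.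
         assignment_weight p a (Suc n) (g(Suc n := l)) * \<phi> (add_mset (fst l) (blocks n g)))"
    by (simp only: sum_assignments_Suc blocks_upd)
  also have "\<dots> = (\<Sum>g\<in>assignments r k n. assignment_weight p a n g *
      (\<Sum>f\<le>k. insert_weight k x p f (blocks n g) * \<phi> (add_mset f (blocks n g))))"
    unfolding x_def by (intro sum.cong refl assignment_weight_upd_sum[OF assms(1)])
  \<comment> \<open>The insertion sum depends on the assignment only through its blocks, so it can
    serve as the test function of the induction hypothesis.\<close>
  also have "\<dots> = (\<Sum>M\<in>multisets_of_size {..k} n. \<Sum>f\<le>k.
      hat_multinom k x p M * insert_weight k x p f M * \<phi> (add_mset f M))"
    by (subst Suc.IH[of "\<lambda>M. \<Sum>f\<le>k. insert_weight k x p f M * \<phi> (add_mset f M)"])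
      (simp add: sum_distrib_left mult.assoc)
  \<comment> \<open>Regrouping by the multiset after insertion makes \<open>hat_multinom_rec\<close>
    applicable.\<close>
  also have "\<dots> = (\<Sum>M\<in>multisets_of_size {..k} (Suc n). \<Sum>f\<in>set_mset M.
      hat_multinom k x p (M - {#f#}) * insert_weight k x p f (M - {#f#}) *
      \<phi> (add_mset f (M - {#f#})))"
    by (rule sum_multisets_Suc) simp
  also have "\<dots> = (\<Sum>M\<in>multisets_of_size {..k} (Suc n). (\<Sum>f\<in>set_mset M.
      hat_multinom k x p (M - {#f#}) * insert_weight k x p f (M - {#f#})) * \<phi> M)"
    by (simp add: sum_distrib_right)
  also have "\<dots> = (\<Sum>M\<in>multisets_of_size {..k} (Suc n). hat_multinom k x p M * \<phi> M)"
    by (intro sum.cong refl, subst hat_multinom_rec[OF nz]) (auto simp: multisets_of_size_def)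
  finally show ?case .
qed

section \<open>Sorting an assignment\<close>

text \<open>Ranking by \<open>R\<close> is a bijection of \<open>{1..n}\<close> and its inverse
  sorts. Conversely, any sorting permutation puts the element of rank \<open>i\<close> at position
  \<open>i\<close>, which gives uniqueness.\<close>

lemma ex1_sorting_permutation:
  fixes R :: "nat \<Rightarrow> nat \<Rightarrow> bool"
  assumes irrefl: "\<And>v. \<not> R v v" and trans: "\<And>u v w. R u v \<Longrightarrow> R v w \<Longrightarrow> R u w"
    and total: "\<And>v w. v \<noteq> w \<Longrightarrow> R v w \<or> R w v"
  shows "\<exists>!\<sigma>. \<sigma> permutes {1..n} \<and> (\<forall>i\<in>{1..n}. \<forall>j\<in>{1..n}. i < j \<longrightarrow> R (\<sigma> i) (\<sigma> j))"
proof -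
  \<comment> \<open>Counting \<open>v\<close> itself makes the ranks start at 1.\<close>
  define rank where "rank v = card {w\<in>{1..n}. w = v \<or> R w v}" for v
  have rank_less: "rank v < rank w" if "R v w" "w \<in> {1..n}" for v w
    unfolding rank_def
  proof (rule psubset_card_mono)
    have "\<not> R w v" "w \<noteq> v" using that irrefl trans by blast+
    then show "{u\<in>{1..n}. u = v \<or> R u v} \<subset> {u\<in>{1..n}. u = w \<or> R u w}"
      using that trans by blast
  qed simp
  have rank_inj: "inj_on rank {1..n}"
    by (rule inj_onI) (metis rank_less total less_irrefl)
  have "rank ` {1..n} \<subseteq> {1..n}"
  proof
    fix y assume "y \<in> rank ` {1..n}"
    then obtain v where v: "v \<in> {1..n}" "y = rank v" by auto
    have "card {v} \<le> rank v" unfolding rank_def using v by (intro card_mono) auto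
    then have "1 \<le> rank v" by simp
    moreover have "rank v \<le> card {1..n}" unfolding rank_def by (rule card_mono) auto
    ultimately show "y \<in> {1..n}" using v by simp
  qed
  with rank_inj have rank_bij: "bij_betw rank {1..n} {1..n}"
    by (simp add: bij_betw_def endo_inj_surj)
  \<comment> \<open>A permutation of \<open>{1..n}\<close> has to be the identity elsewhere.\<close>
  define \<tau> where "\<tau> i = (if i \<in> {1..n} then inv_into {1..n} rank i else i)" for i
  have "bij_betw \<tau> {1..n} {1..n}"
    using bij_betw_inv_into[OF rank_bij]
    by (subst bij_betw_cong[of _ _ "inv_into {1..n} rank"]) (auto simp: \<tau>_def)
  then have perm: "\<tau> permutes {1..n}"
    by (rule bij_imp_permutes) (auto simp: \<tau>_def)
  have rank_\<tau>: "rank (\<tau> i) = i" if "i \<in> {1..n}" for i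
    using that rank_bij by (simp add: \<tau>_def bij_betw_def f_inv_into_f)
  have sorted: "R (\<tau> i) (\<tau> j)" if "i \<in> {1..n}" "j \<in> {1..n}" "i < j" for i j
  proof (rule ccontr)
    assume "\<not> R (\<tau> i) (\<tau> j)"
    then have "\<tau> j = \<tau> i \<or> R (\<tau> j) (\<tau> i)" using total by auto
    then have "rank (\<tau> j) \<le> rank (\<tau> i)"
      using rank_less[of "\<tau> j" "\<tau> i"] permutes_in_image[OF perm, of i] that by auto
    with that show False by (simp add: rank_\<tau>)
  qed
  have unique: "rank (\<sigma> i) = i" if \<sigma>: "\<sigma> permutes {1..n}"
    and s: "\<forall>i\<in>{1..n}. \<forall>j\<in>{1..n}. i < j \<longrightarrow> R (\<sigma> i) (\<sigma> j)" and i: "i \<in> {1..n}" for \<sigma> i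
  proof -
    \<comment> \<open>What does not come after \<open>\<sigma> i\<close> is exactly what occupies
      the positions up to \<open>i\<close>.\<close>
    have "{w\<in>{1..n}. w = \<sigma> i \<or> R w (\<sigma> i)} = \<sigma> ` {1..i}"
    proof (intro equalityI subsetI)
      fix w assume w: "w \<in> {w\<in>{1..n}. w = \<sigma> i \<or> R w (\<sigma> i)}"
      then obtain j where j: "j \<in> {1..n}" "w = \<sigma> j" using permutes_image[OF \<sigma>] by blast
      have "\<not> i < j" using w j s i irrefl trans by (metis (mono_tags, lifting) mem_Collect_eq)
      with j show "w \<in> \<sigma> ` {1..i}" by auto
    next
      fix w assume "w \<in> \<sigma> ` {1..i}"
      then obtain j where "w = \<sigma> j" "j \<in> {1..n}" "j = i \<or> j < i" using i by force
      then show "w \<in> {w\<in>{1..n}. w = \<sigma> i \<or> R w (\<sigma> i)}"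
        using s i permutes_in_image[OF \<sigma>, of j] by auto
    qed
    then show ?thesis
      using permutes_inj_on[OF \<sigma>, of "{1..i}"] by (simp add: rank_def card_image)
  qed
  show ?thesis
  proof (rule ex1I[of _ \<tau>])
    show "\<tau> permutes {1..n} \<and> (\<forall>i\<in>{1..n}. \<forall>j\<in>{1..n}. i < j \<longrightarrow> R (\<tau> i) (\<tau> j))"
      using perm sorted by blast
  next
    fix \<sigma>
    assume \<sigma>: "\<sigma> permutes {1..n} \<and> (\<forall>i\<in>{1..n}. \<forall>j\<in>{1..n}. i < j \<longrightarrow> R (\<sigma> i) (\<sigma> j))"
    show "\<sigma> = \<tau>"
    proof
      fix i
      show "\<sigma> i = \<tau> i"
      proof (cases "i \<in> {1..n}")
        case True
        then have "rank (\<sigma> i) = rank (\<tau> i)" using unique[of \<sigma> i] \<sigma> rank_\<tau> by simp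
        then show ?thesis
          using rank_inj True permutes_in_image[OF perm, of i] permutes_in_image[of \<sigma> "{1..n}" i] \<sigma>
          by (simp add: inj_on_eq_iff)
      next
        case False
        then show ?thesis using \<sigma> perm by (metis permutes_not_in)
      qed
    qed
  qed
qed

section \<open>The order of letters and the chain condition\<close>

definition letter_before :: "nat \<times> colored \<Rightarrow> nat \<times> colored \<Rightarrow> bool" where
  "letter_before L L' \<longleftrightarrow> fst L' < fst L \<or> fst L = fst L' \<and> colored_less (snd L) (snd L')"

lemma colored_less_irrefl: "\<not> colored_less v v"
  by (cases v) (simp add: colored_less_def)

lemma colored_less_trans: "colored_less u v \<Longrightarrow> colored_less v w \<Longrightarrow> colored_less u w"
  by (cases u; cases v; cases w) (auto simp: colored_less_def split: if_splits)

lemma colored_less_asym: "colored_less v w \<Longrightarrow> \<not> colored_less w v"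
  using colored_less_irrefl colored_less_trans by blast

lemma colored_less_total: "fst v \<noteq> fst w \<Longrightarrow> colored_less v w \<or> colored_less w v"
  by (cases v; cases w) (auto simp: colored_less_def)

lemma letter_before_trans: "letter_before u v \<Longrightarrow> letter_before v w \<Longrightarrow> letter_before u w"
  unfolding letter_before_def by (auto dest: colored_less_trans)

definition letter :: "(nat \<Rightarrow> nat \<times> nat) \<Rightarrow> nat \<Rightarrow> nat \<times> colored" where
  "letter g v = (fst (g v), (v, snd (g v)))"

definition sorts :: "nat \<Rightarrow> (nat \<Rightarrow> nat \<times> nat) \<Rightarrow> (nat \<Rightarrow> nat) \<Rightarrow> bool" where
  "sorts n g \<sigma> \<longleftrightarrow> \<sigma> permutes {1..n} \<and>
     (\<forall>i\<in>{1..n}. \<forall>j\<in>{1..n}. i < j \<longrightarrow> letter_before (letter g (\<sigma> i)) (letter g (\<sigma> j)))"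

lemma ex1_sorts: "\<exists>!\<sigma>. sorts n g \<sigma>"
  unfolding sorts_def
proof (rule ex1_sorting_permutation)
  show "\<not> letter_before (letter g v) (letter g v)" for v
    by (simp add: letter_before_def colored_less_irrefl)
  show "letter_before (letter g v) (letter g w) \<or> letter_before (letter g w) (letter g v)"
    if "v \<noteq> w" for v w
    using colored_less_total[of "(v, snd (g v))" "(w, snd (g w))"] that
    by (auto simp: letter_before_def letter_def)
qed (rule letter_before_trans)

text \<open>Weak decrease with strictness at descents says precisely that consecutive letters are in
  order; transitivity extends this to all pairs. Position \<open>0\<close> with its entry
  \<open>(0, 0)\<close> takes part, which encodes the restriction on block \<open>k\<close>.\<close>

lemma chains_Des_G_iff:
  assumes "\<sigma> permutes {1..n}" "f \<in> {0..n} \<rightarrow>\<^sub>E UNIV" "f 0 = k"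
  shows "f \<in> chains 0 n (Des_G n (c, \<sigma>)) k \<longleftrightarrow>
    (\<forall>i j. i < j \<longrightarrow> j \<le> n \<longrightarrow>
       letter_before (f i, window (c, \<sigma>) i) (f j, window (c, \<sigma>) j))"
    (is "_ \<longleftrightarrow> (\<forall>i j. _ \<longrightarrow> _ \<longrightarrow> ?B i j)")
proof
  assume f: "f \<in> chains 0 n (Des_G n (c, \<sigma>)) k"
  have Suc_step: "?B i (Suc i)" if "i < n" for i
  proof -
    have "f (Suc i) + of_bool (i \<in> Des_G n (c, \<sigma>)) \<le> f i"
      using chains_step[OF f _ that] by simp
    \<comment> \<open>Totality needs distinct absolute values; for \<open>i = 0\<close> this holds
      because \<open>\<sigma>\<close> never takes the value \<open>0\<close> on
      \<open>{1..n}\<close>.\<close>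
    moreover have "fst (window (c, \<sigma>) i) \<noteq> fst (window (c, \<sigma>) (Suc i))"
      using permutes_inj[OF assms(1)] permutes_in_image[OF assms(1), of "Suc i"] that
      by (auto simp: window_def inj_eq)
    then have "i \<notin> Des_G n (c, \<sigma>) \<Longrightarrow> colored_less (window (c, \<sigma>) i) (window (c, \<sigma>) (Suc i))"
      using that colored_less_total[of "window (c, \<sigma>) i" "window (c, \<sigma>) (Suc i)"]
      by (auto simp: Des_G_def)
    ultimately show ?thesis
      by (cases "i \<in> Des_G n (c, \<sigma>)") (auto simp: letter_before_def)
  qed
  have "?B i j" if "i < j" "j \<le> n" for i j
    using that(1)[folded Suc_le_eq] that(2)
  proof (induction rule: dec_induct)
    case base then show ?case by (simp add: Suc_step)
  next
    case (step l)
    then have "?B i l" "?B l (Suc l)" by (auto intro: Suc_step)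
    then show ?case by (rule letter_before_trans)
  qed
  then show "\<forall>i j. i < j \<longrightarrow> j \<le> n \<longrightarrow> ?B i j" by blast
next
  assume "\<forall>i j. i < j \<longrightarrow> j \<le> n \<longrightarrow> ?B i j"
  then have "?B i (Suc i)" if "i < n" for i using that by simp
  then have "f (Suc i) + of_bool (i \<in> Des_G n (c, \<sigma>)) \<le> f i" if "i < n" for i
    using that by (fastforce simp: letter_before_def Des_G_def dest: colored_less_asym)
  with assms show "f \<in> chains 0 n (Des_G n (c, \<sigma>)) k" by (simp add: chains_def)
qed

section \<open>The bijection between chained permutations and assignments\<close>

definition to_assignment :: "nat \<Rightarrow> colored_perm \<times> (nat \<Rightarrow> nat) \<Rightarrow> nat \<Rightarrow> nat \<times> nat" where
  "to_assignment n = (\<lambda>((c, \<sigma>), f). \<lambda>v\<in>{1..n}. (f (inv \<sigma> v), c (inv \<sigma> v)))"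

definition of_assignment :: "nat \<Rightarrow> nat \<Rightarrow> (nat \<Rightarrow> nat \<times> nat) \<Rightarrow> colored_perm \<times> (nat \<Rightarrow> nat)" where
  "of_assignment k n g = (let \<sigma> = THE \<sigma>. sorts n g \<sigma> in
     ((\<lambda>i\<in>{1..n}. snd (g (\<sigma> i)), \<sigma>), \<lambda>i\<in>{0..n}. if i = 0 then k else fst (g (\<sigma> i))))"

definition chained_perms :: "nat \<Rightarrow> nat \<Rightarrow> nat \<Rightarrow> (colored_perm \<times> (nat \<Rightarrow> nat)) set" where
  "chained_perms r k n = (SIGMA \<gamma>:colored_perms r n. chains 0 n (Des_G n \<gamma>) k)"

lemma chained_permsD:
  assumes "((c, \<sigma>), f) \<in> chained_perms r k n"
  shows "c \<in> {1..n} \<rightarrow>\<^sub>E {0..<r}" "\<sigma> permutes {1..n}" "f \<in> {0..n} \<rightarrow>\<^sub>E UNIV" "f 0 = k"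
    "\<And>i j. i < j \<Longrightarrow> j \<le> n \<Longrightarrow> letter_before (f i, window (c, \<sigma>) i) (f j, window (c, \<sigma>) j)"
proof -
  show *: "c \<in> {1..n} \<rightarrow>\<^sub>E {0..<r}" "\<sigma> permutes {1..n}" "f \<in> {0..n} \<rightarrow>\<^sub>E UNIV" "f 0 = k"
    using assms by (auto simp: chained_perms_def colored_perms_def chains_def)
  show "letter_before (f i, window (c, \<sigma>) i) (f j, window (c, \<sigma>) j)" if "i < j" "j \<le> n" for i j
    using assms that chains_Des_G_iff[OF *(2-4), of c] by (simp add: chained_perms_def)
qed

lemma to_assignment_apply:
  assumes "\<sigma> permutes {1..n}" "i \<in> {1..n}"
  shows "to_assignment n ((c, \<sigma>), f) (\<sigma> i) = (f i, c i)"
proof -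
  have "\<sigma> i \<in> {1..n}" using permutes_in_image[OF assms(1), of i] assms(2) by blast
  then show ?thesis
    by (simp only: to_assignment_def prod.case restrict_apply if_True permutes_inverses(2)[OF assms(1)])
qed

lemma sorts_to_assignment:
  assumes "((c, \<sigma>), f) \<in> chained_perms r k n"
  shows "sorts n (to_assignment n ((c, \<sigma>), f)) \<sigma>"
  using chained_permsD(5)[OF assms] chained_permsD(2)[OF assms]
  by (force simp: sorts_def letter_def to_assignment_apply window_def)

text \<open>The permutation \<open>\<sigma>\<close> itself sorts the assignment built from it, so
  uniqueness of the sorting permutation recovers it; \<open>c\<close> and \<open>f\<close> are then
  read off along \<open>\<sigma>\<close>.\<close>

lemma of_to_assignment:
  assumes "((c, \<sigma>), f) \<in> chained_perms r k n"
  shows "of_assignment k n (to_assignment n ((c, \<sigma>), f)) = ((c, \<sigma>), f)"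
proof -
  note D = chained_permsD[OF assms]
  have "(THE \<tau>. sorts n (to_assignment n ((c, \<sigma>), f)) \<tau>) = \<sigma>"
    using ex1_sorts sorts_to_assignment[OF assms] by (metis the1_equality)
  moreover have "(\<lambda>i\<in>{1..n}. snd (to_assignment n ((c, \<sigma>), f) (\<sigma> i))) = c"
    using D(1) by (auto simp: fun_eq_iff to_assignment_apply[OF D(2)] PiE_iff extensional_def)
  moreover have "(\<lambda>i\<in>{0..n}. if i = 0 then k else fst (to_assignment n ((c, \<sigma>), f) (\<sigma> i))) = f"
    using D(3,4) by (auto simp: fun_eq_iff to_assignment_apply[OF D(2)] PiE_iff extensional_def)
  ultimately show ?thesis by (simp add: of_assignment_def)
qed

lemma to_assignment_in:
  assumes "((c, \<sigma>), f) \<in> chained_perms r k n"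
  shows "to_assignment n ((c, \<sigma>), f) \<in> assignments r k n"
proof -
  note D = chained_permsD[OF assms]
  have "to_assignment n ((c, \<sigma>), f) v \<in> letters r k" if "v \<in> {1..n}" for v
  proof -
    have "v \<in> \<sigma> ` {1..n}" using that by (simp only: permutes_image[OF D(2)])
    then obtain i where i: "i \<in> {1..n}" "v = \<sigma> i" by blast
    moreover have "c i < r" using D(1) i by auto
    \<comment> \<open>Comparison with position \<open>0\<close>: in block \<open>k\<close> the entry
      at \<open>i\<close> must exceed \<open>(0, 0)\<close>, hence be uncolored.\<close>
    moreover have "f i < k \<or> f i = k \<and> c i = 0"
      using D(5)[of 0 i] D(4) i by (auto simp: letter_before_def window_def colored_less_def split: if_splits)
    ultimately show ?thesis
      using to_assignment_apply[OF D(2), of i c f] by (auto simp: letters_def)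
  qed
  moreover have "to_assignment n ((c, \<sigma>), f) \<in> extensional {1..n}"
    by (simp add: to_assignment_def)
  ultimately show ?thesis by (simp add: assignments_def PiE_iff)
qed

lemma of_assignment_in:
  assumes "g \<in> assignments r k n"
  shows "of_assignment k n g \<in> chained_perms r k n"
proof -
  define \<sigma> where "\<sigma> = (THE \<sigma>. sorts n g \<sigma>)"
  have s: "sorts n g \<sigma>" unfolding \<sigma>_def by (rule theI'[OF ex1_sorts])
  then have perm: "\<sigma> permutes {1..n}" by (simp add: sorts_def)
  define c where "c = (\<lambda>i\<in>{1..n}. snd (g (\<sigma> i)))"
  define f where "f = (\<lambda>i\<in>{0..n}. if i = 0 then k else fst (g (\<sigma> i)))"
  have lett: "g (\<sigma> i) \<in> letters r k" "0 < \<sigma> i" if "i \<in> {1..n}" for i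
    using permutes_in_image[OF perm, of i] that assms by (auto simp: assignments_def)
  have "c \<in> {1..n} \<rightarrow>\<^sub>E {0..<r}" unfolding c_def using lett(1) by (fastforce simp: letters_def)
  moreover have "letter_before (f i, window (c, \<sigma>) i) (f j, window (c, \<sigma>) j)"
    if "i < j" "j \<le> n" for i j
  \<comment> \<open>Position \<open>0\<close> is not covered by \<open>sorts\<close>; its letter
    \<open>(k, (0, 0))\<close> comes first because block \<open>k\<close> contains only uncolored
    positive values.\<close>
  proof (cases "i = 0")
    case True
    then show ?thesis using that lett[of j]
      by (auto simp: letter_before_def window_def f_def c_def letters_def colored_less_def)
  next
    case False
    then show ?thesis using that s by (auto simp: sorts_def f_def c_def window_def letter_def)
  qed
  moreover have "f \<in> {0..n} \<rightarrow>\<^sub>E UNIV" "f 0 = k" by (auto simp: f_def)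
  ultimately have "((c, \<sigma>), f) \<in> chained_perms r k n"
    using perm chains_Des_G_iff[OF perm, of f k c]
    by (simp add: chained_perms_def colored_perms_def)
  then show ?thesis
    by (simp only: of_assignment_def Let_def \<sigma>_def c_def f_def)
qed

lemma to_of_assignment:
  assumes "g \<in> assignments r k n"
  shows "to_assignment n (of_assignment k n g) = g"
proof -
  define \<sigma> where "\<sigma> = (THE \<sigma>. sorts n g \<sigma>)"
  have "sorts n g \<sigma>" unfolding \<sigma>_def by (rule theI'[OF ex1_sorts])
  then have perm: "\<sigma> permutes {1..n}" by (simp add: sorts_def)
  have "to_assignment n (of_assignment k n g) v = g v" if v: "v \<in> {1..n}" for v
  proof -
    obtain i where i: "i \<in> {1..n}" "v = \<sigma> i" using v permutes_image[OF perm] by blast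
    then show ?thesis
      by (auto simp: of_assignment_def to_assignment_apply[OF perm] simp flip: \<sigma>_def)
  qed
  moreover have "to_assignment n (of_assignment k n g) v = g v" if "v \<notin> {1..n}" for v
  proof -
    have "g v = undefined" using assms that by (auto simp: assignments_def PiE_iff extensional_def)
    moreover have "to_assignment n y v = undefined" for y
      using that by (simp only: to_assignment_def split_def restrict_apply if_False)
    ultimately show ?thesis by simp
  qed
  ultimately show ?thesis by blast
qed

text \<open>The map \<open>\<sigma>\<close> carries inverted positions to inverted values. An
  inversion \<open>i < j\<close> forces \<open>f j < f i\<close>, since equal blocks are sorted
  increasingly; conversely \<open>f j < f i\<close> forces \<open>i < j\<close>, since
  \<open>f\<close> decreases weakly.\<close>

lemma assignment_length_to_assignment:
  assumes "((c, \<sigma>), f) \<in> chained_perms r k n"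
  shows "assignment_length n (to_assignment n ((c, \<sigma>), f)) = length_G n (c, \<sigma>)"
proof -
  note D = chained_permsD[OF assms]
  let ?g = "to_assignment n ((c, \<sigma>), f)"
  note ta = to_assignment_apply[OF D(2)]
  have img: "\<sigma> ` {1..n} = {1..n}" by (rule permutes_image[OF D(2)])
  have inj: "inj \<sigma>" by (rule permutes_inj[OF D(2)])
  define I where "I = {(i, j). 1 \<le> i \<and> i < j \<and> j \<le> n \<and>
     colored_less (window (c, \<sigma>) j) (window (c, \<sigma>) i)}"
  have key: "f j < f i \<and> colored_less (\<sigma> j, c j) (\<sigma> i, c i) \<longleftrightarrow> (i, j) \<in> I"
    if ij: "i \<in> {1..n}" "j \<in> {1..n}" for i j
  proof -
    have "f i \<le> f j" if "j \<le> i"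
      using D(5)[of j i] ij that by (cases "j = i") (auto simp: letter_before_def)
    moreover have "f j < f i" if "i < j" "colored_less (\<sigma> j, c j) (\<sigma> i, c i)"
    proof -
      have "\<not> colored_less (\<sigma> i, c i) (\<sigma> j, c j)"
        using that(2) by (rule colored_less_asym)
      then show ?thesis
        using D(5)[of i j] ij that(1) by (auto simp: letter_before_def window_def)
    qed
    ultimately show ?thesis using ij by (force simp: I_def window_def)
  qed
  have "assignment_invs n ?g = map_prod \<sigma> \<sigma> ` I"
  proof (intro equalityI subsetI)
    fix z assume z: "z \<in> assignment_invs n ?g"
    then have "fst z \<in> \<sigma> ` {1..n}" "snd z \<in> \<sigma> ` {1..n}"
      unfolding img by (auto simp: assignment_invs_def)
    then obtain i j where "z = (\<sigma> i, \<sigma> j)" "i \<in> {1..n}" "j \<in> {1..n}" by (metis imageE prod.collapse)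
    with z have "z = map_prod \<sigma> \<sigma> (i, j)" "(i, j) \<in> I"
      using key[of i j] by (auto simp: assignment_invs_def ta)
    then show "z \<in> map_prod \<sigma> \<sigma> ` I" by blast
  next
    fix z assume "z \<in> map_prod \<sigma> \<sigma> ` I"
    then obtain i j where z: "z = (\<sigma> i, \<sigma> j)" "(i, j) \<in> I" by auto
    then have ij: "i \<in> {1..n}" "j \<in> {1..n}" by (auto simp: I_def)
    have "\<sigma> i \<in> {1..n}" "\<sigma> j \<in> {1..n}" using img ij by blast+
    then show "z \<in> assignment_invs n ?g"
      using z key[OF ij] by (simp add: assignment_invs_def ta[OF ij(1)] ta[OF ij(2)])
  qed
  then have "card (assignment_invs n ?g) = inv_G n (c, \<sigma>)"
    using inj_on_subset[OF prod.inj_map[OF inj inj] subset_UNIV]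
    by (simp only: card_image inv_G_def I_def)
  moreover have "{v\<in>{1..n}. snd (?g v) \<noteq> 0} = \<sigma> ` {i\<in>{1..n}. c i \<noteq> 0}"
  proof -
    have "{v\<in>\<sigma> ` {1..n}. snd (?g v) \<noteq> 0} = \<sigma> ` {i\<in>{1..n}. c i \<noteq> 0}"
      using ta by fastforce
    then show ?thesis unfolding img .
  qed
  then have "(\<Sum>v\<in>{v\<in>{1..n}. snd (?g v) \<noteq> 0}. v + snd (?g v) - 1) =
      (\<Sum>i\<in>{i\<in>{1..n}. c i \<noteq> 0}. \<sigma> i + c i - 1)"
    using permutes_inj_on[OF D(2)] ta by (simp add: sum.reindex)
  ultimately show ?thesis by (simp add: assignment_length_def length_G_def)
qed

section \<open>Transport of weighted sums along the bijection\<close>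

lemma sum_chained_perms:
  "(\<Sum>(\<gamma>, f)\<in>chained_perms r k n. p ^ length_G n \<gamma> * a ^ col n \<gamma> * q ^ (\<Sum>i\<in>{0<..n}. f i)) =
   (\<Sum>g\<in>assignments r k n. assignment_weight p a n g * q ^ (\<Sum>v=1..n. fst (g v)))"
proof (rule sum.reindex_bij_witness[where i = "of_assignment k n" and j = "to_assignment n"])
  fix z assume z: "z \<in> chained_perms r k n"
  obtain c \<sigma> f where z_eq: "z = ((c, \<sigma>), f)" by (metis prod.exhaust)
  note D = chained_permsD[OF z[unfolded z_eq]]
  let ?g = "to_assignment n z"
  have sum_eq: "(\<Sum>v=1..n. h (?g v)) = (\<Sum>i=1..n. h (f i, c i))" for h :: "nat \<times> nat \<Rightarrow> nat"
    using sum.permute[OF D(2), of "\<lambda>v. h (?g v)"] to_assignment_apply[OF D(2)]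
    by (simp add: z_eq)
  have "{0<..n} = {1..n}" by auto
  then show "assignment_weight p a n ?g * q ^ (\<Sum>v=1..n. fst (?g v)) =
      (case z of (\<gamma>, f) \<Rightarrow> p ^ length_G n \<gamma> * a ^ col n \<gamma> * q ^ (\<Sum>i\<in>{0<..n}. f i))"
    using assignment_length_to_assignment[OF z[unfolded z_eq]] sum_eq[of fst] sum_eq[of snd]
    by (simp add: z_eq assignment_weight_def col_def)
  show "of_assignment k n ?g = z" using of_to_assignment z z_eq by blast
  show "?g \<in> assignments r k n" using to_assignment_in z z_eq by blast
next
  fix g assume g: "g \<in> assignments r k n"
  show "to_assignment n (of_assignment k n g) = g" by (rule to_of_assignment[OF g])
  show "of_assignment k n g \<in> chained_perms r k n" by (rule of_assignment_in[OF g])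
qed

lemma finite_colored_perms: "finite (colored_perms r n)"
  by (simp add: colored_perms_def finite_PiE finite_permutations)

lemma sum_chain_poly:
  "(\<Sum>\<gamma>\<in>colored_perms r n. p ^ length_G n \<gamma> * a ^ col n \<gamma> * chain_poly 0 n (Des_G n \<gamma>) q k) =
   (\<Sum>g\<in>assignments r k n. assignment_weight p a n g * q ^ (\<Sum>v=1..n. fst (g v)))"
  unfolding sum_chained_perms[symmetric] chained_perms_def
  by (subst sum.Sigma[symmetric])
    (auto simp: chain_poly_def sum_distrib_left finite_colored_perms finite_chains)

section \<open>The generating function\<close>

text \<open>A choice of exponents with sum \<open>n\<close>, one for each of the
  \<open>k + 1\<close> factors, is a multiset of size \<open>n\<close> over \<open>{..k}\<close>
  whose counts are the exponents. The dilations collect into the product of the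
  \<open>q ^ i\<close>.\<close>

lemma q_exp_prod_nth:
  fixes p q x :: "'a::field"
  shows "((\<Prod>i<k. fps_dilate (q_exp p) (q ^ i)) * fps_dilate (q_hat_exp x p) (q ^ k)) $ n =
    (\<Sum>M\<in>multisets_of_size {..k} n.
       (\<Prod>i\<in>#M. q ^ i) / (\<Prod>i\<le>k. block_fact k x p i (count M i)))"
proof -
  let ?h = "\<lambda>i. if i < k then fps_dilate (q_exp p) (q ^ i) else fps_dilate (q_hat_exp x p) (q ^ i)"
  have "(\<Prod>i<k. fps_dilate (q_exp p) (q ^ i)) * fps_dilate (q_hat_exp x p) (q ^ k) = (\<Prod>i\<le>k. ?h i)"
    by (simp flip: lessThan_Suc_atMost)
  moreover have "(\<Prod>i\<le>k. ?h i $ count M i) =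
      (\<Prod>i\<in>#M. q ^ i) / (\<Prod>i\<le>k. block_fact k x p i (count M i))"
    if M: "M \<in> multisets_of_size {..k} n" for M
  proof -
    have "(\<Prod>i\<in>#M. q ^ i) = (\<Prod>i\<in>set_mset M. (q ^ i) ^ count M i)"
      by (rule image_prod_mset_multiplicity)
    also have "\<dots> = (\<Prod>i\<le>k. (q ^ i) ^ count M i)"
      using M by (intro prod.mono_neutral_left) (auto simp: multisets_of_size_def not_in_iff)
    finally show ?thesis
      unfolding prod_dividef[symmetric]
      by (auto simp: block_fact_def q_exp_def q_hat_exp_def prod_dividef[symmetric] intro!: prod.cong)
  qed
  ultimately show ?thesis by (simp add: fps_prod_nth')
qed

text \<open>Both elements are polynomials, and setting first \<open>q\<close> and then
  \<open>p\<close> to 0 leaves the constant 1.\<close>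

lemma q_fract_nonzero:
  "q_int (Suc n) var_p \<noteq> (0 :: ratfun)"
  "1 + var_a * q_int m (var_a * var_p) * var_p ^ Suc n \<noteq> (0 :: ratfun)"
proof -
  define P A :: "rat poly poly poly" where "P = [:[:0, 1:]:]" and "A = [:[:[:0, 1:]:]:]"
  have pow: "to_fract (y ^ i) = to_fract y ^ i" for y :: "rat poly poly poly" and i
    by (induction i) simp_all
  have "q_int (Suc n) var_p = to_fract (\<Sum>i<Suc n. P ^ i)"
    by (simp add: q_int_def var_p_def P_def pow Fract_conv_to_fract)
  moreover have "poly (poly (\<Sum>i<Suc n. P ^ i) 0) 0 = 1"
    by (simp add: P_def poly_sum poly_power power_0_left)
  ultimately show "q_int (Suc n) var_p \<noteq> (0 :: ratfun)"
    by (metis to_fract_eq_0_iff poly_0 zero_neq_one)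
  have "1 + var_a * q_int m (var_a * var_p) * var_p ^ Suc n =
      to_fract (1 + A * (\<Sum>i<m. (A * P) ^ i) * P ^ Suc n)"
    unfolding to_fract_add to_fract_mult to_fract_sum pow to_fract_1 q_int_def
    by (simp only: var_p_def var_a_def P_def A_def Fract_conv_to_fract to_fract_1 div_by_1)
  moreover have "poly (poly (1 + A * (\<Sum>i<m. (A * P) ^ i) * P ^ Suc n) 0) 0 = 1"
    by (simp add: P_def)
  ultimately show "1 + var_a * q_int m (var_a * var_p) * var_p ^ Suc n \<noteq> (0 :: ratfun)"
    by (metis to_fract_eq_0_iff poly_0 zero_neq_one)
qed

lemma q_hat_fact_var_nonzero:
  "q_hat_fact n (var_a * q_int m (var_a * var_p)) var_p \<noteq> (0 :: ratfun)"
proof (induction n)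
  case 0
  show ?case by (simp add: q_hat_fact_def q_poch_def q_fact_def)
next
  case (Suc n)
  then show ?case unfolding q_hat_fact_Suc by (simp only: q_fract_nonzero mult_eq_0_iff) simp
qed

lemma fps2_suminf_powers_u:
  "fps2_suminf (\<lambda>n. ps_u ^ n * of_t_series (F n)) = Abs_fps F"
proof (rule fps2_suminf_eq)
  have "(\<Sum>i<N. ps_u ^ i * of_t_series (F i)) $ m $ n = F m $ n" if "N > m" for m n N
  proof -
    have "(ps_u ^ i * of_t_series (F i)) $ m $ n = (if i = m then F m $ n else 0)" for i
      by (auto simp: ps_u_def of_t_series_def fps_X_power_mult_nth)
    with that show ?thesis by (simp add: fps_sum_nth)
  qed
  then show "fps2_sums (\<lambda>n. ps_u ^ n * of_t_series (F n)) (Abs_fps F)"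
    by (auto simp: fps2_sums_def intro!: eventually_mono[OF eventually_gt_at_top[of _]])
qed

text \<open>The outer variable is \<open>u\<close>, so collecting by powers of \<open>t\<close>
  transposes the array of coefficients.\<close>

lemma fps2_suminf_powers_t:
  "fps2_suminf (\<lambda>k. ps_t ^ k * of_u_series (F k)) = Abs_fps (\<lambda>n. Abs_fps (\<lambda>k. F k $ n))"
proof (rule fps2_suminf_eq)
  have "(\<Sum>i<N. ps_t ^ i * of_u_series (F i)) $ m $ n = F n $ m" if "N > n" for m n N
  proof -
    have "(ps_t ^ i * of_u_series (F i)) $ m $ n = (if i = n then F n $ m else 0)" for i
      by (auto simp: ps_t_def of_u_series_def fps_X_power_mult_nth fps_const_power)
    with that show ?thesis by (simp add: fps_sum_nth)
  qed
  then show "fps2_sums (\<lambda>k. ps_t ^ k * of_u_series (F k)) (Abs_fps (\<lambda>n. Abs_fps (\<lambda>k. F k $ n)))"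
    by (auto simp: fps2_sums_def intro!: eventually_mono[OF eventually_gt_at_top[of _]])
qed

text \<open>The coefficient of u^n in the identity, cleared of denominators. \<open>chain_gf\<close>
  exchanges t^des q^maj for a series in \<open>k\<close>; at fixed \<open>k\<close> the sum over
  permutations becomes one over assignments and then one over block sizes.\<close>

lemma colored_gen_poly_eq:
  fixes q p a :: "'a::field"
  assumes "r \<ge> 1"
  defines "x \<equiv> a * q_int (r - 1) (a * p)"
  assumes nz: "\<And>j. q_hat_fact j x p \<noteq> 0"
  shows "colored_gen_poly r n q p a = q_poch fps_X (fps_const q) (n + 1) * fps_const (q_hat_fact n x p) *
    Abs_fps (\<lambda>k. ((\<Prod>i<k. fps_dilate (q_exp p) (q ^ i)) * fps_dilate (q_hat_exp x p) (q ^ k)) $ n)"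
proof -
  define w where "w \<gamma> = p ^ length_G n \<gamma> * a ^ col n \<gamma>" for \<gamma>
  have des: "fps_X ^ des_G n \<gamma> * fps_const (q ^ maj n \<gamma>) =
      q_poch fps_X (fps_const q) (n + 1) * Abs_fps (chain_poly 0 n (Des_G n \<gamma>) q)" for \<gamma>
  proof -
    have "Des_G n \<gamma> \<inter> {0..<n} = Des_G n \<gamma>" by (auto simp: Des_G_def)
    then show ?thesis using chain_gf[of 0 n q "Des_G n \<gamma>"] by (simp add: des_G_def maj_def)
  qed
  have coeff: "(\<Sum>\<gamma>\<in>colored_perms r n. w \<gamma> * chain_poly 0 n (Des_G n \<gamma>) q k) = q_hat_fact n x p *
      ((\<Prod>i<k. fps_dilate (q_exp p) (q ^ i)) * fps_dilate (q_hat_exp x p) (q ^ k)) $ n" for k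
  proof -
    have "(\<Sum>\<gamma>\<in>colored_perms r n. w \<gamma> * chain_poly 0 n (Des_G n \<gamma>) q k) =
        (\<Sum>g\<in>assignments r k n. assignment_weight p a n g * (\<Prod>i\<in>#blocks n g. q ^ i))"
      \<comment> \<open>The power of \<open>q\<close> has to be written as a function of the blocks
        to act as the test function in \<open>sum_assignments\<close>.\<close>
      unfolding w_def sum_chain_poly
      by (simp add: blocks_def power_sum multiset.map_comp comp_def prod_unfold_prod_mset)
    also have "\<dots> = (\<Sum>M\<in>multisets_of_size {..k} n. hat_multinom k x p M * (\<Prod>i\<in>#M. q ^ i))"
      unfolding x_def using nz[unfolded x_def] by (rule sum_assignments[OF assms(1)])
    also have "\<dots> = q_hat_fact n x p * (\<Sum>M\<in>multisets_of_size {..k} n.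
        (\<Prod>i\<in>#M. q ^ i) / (\<Prod>i\<le>k. block_fact k x p i (count M i)))"
      unfolding sum_distrib_left
      by (intro sum.cong) (auto simp: hat_multinom_def multisets_of_size_def)
    finally show ?thesis by (simp only: q_exp_prod_nth)
  qed
  have "colored_gen_poly r n q p a = (\<Sum>\<gamma>\<in>colored_perms r n.
      fps_X ^ des_G n \<gamma> * fps_const (q ^ maj n \<gamma>) * fps_const (w \<gamma>))"
    by (simp add: colored_gen_poly_def w_def mult.assoc)
  also have "\<dots> = q_poch fps_X (fps_const q) (n + 1) * (\<Sum>\<gamma>\<in>colored_perms r n.
      fps_const (w \<gamma>) * Abs_fps (chain_poly 0 n (Des_G n \<gamma>) q))"
    unfolding des sum_distrib_left by (intro sum.cong refl) (simp only: mult_ac)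
  also have "(\<Sum>\<gamma>\<in>colored_perms r n. fps_const (w \<gamma>) * Abs_fps (chain_poly 0 n (Des_G n \<gamma>) q)) =
      fps_const (q_hat_fact n x p) * Abs_fps (\<lambda>k.
        ((\<Prod>i<k. fps_dilate (q_exp p) (q ^ i)) * fps_dilate (q_hat_exp x p) (q ^ k)) $ n)"
    by (rule fps_ext) (simp add: fps_sum_nth coeff)
  finally show ?thesis by (simp only: mult.assoc)
qed

theorem theorem5p1:
  fixes r :: nat and q p a x :: ratfun
  assumes "r \<ge> 1"
  defines "q \<equiv> var_q" and "p \<equiv> var_p" and "a \<equiv> var_a"
  defines "x \<equiv> a * q_int (r - 1) (a * p)"
  shows "fps2_suminf (\<lambda>n. ps_u ^ n * of_t_series
             (colored_gen_poly r n q p a /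
               (q_poch fps_X (fps_const q) (n + 1) * fps_const (q_hat_fact n x p))))
       = fps2_suminf (\<lambda>k. ps_t ^ k * of_u_series
             ((\<Prod>i<k. fps_dilate (q_exp p) (q ^ i)) * fps_dilate (q_hat_exp x p) (q ^ k)))"
proof -
  have nz: "q_hat_fact j x p \<noteq> 0" for j
    unfolding x_def p_def a_def by (rule q_hat_fact_var_nonzero)
  \<comment> \<open>The constant term in \<open>t\<close> shows that the Pochhammer product is a
    nonzero series, so the division of series cancels it.\<close>
  have "q_poch fps_X (fps_const q) n $ 0 = 1" for n
    by (induction n) (simp_all add: q_poch_def)
  then have "q_poch fps_X (fps_const q) (n + 1) * fps_const (q_hat_fact n x p) \<noteq> 0" for n
    using nz by (metis fps_const_eq_0_iff fps_zero_nth mult_eq_0_iff zero_neq_one)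
  then have "colored_gen_poly r n q p a /
      (q_poch fps_X (fps_const q) (n + 1) * fps_const (q_hat_fact n x p)) = Abs_fps (\<lambda>k.
        ((\<Prod>i<k. fps_dilate (q_exp p) (q ^ i)) * fps_dilate (q_hat_exp x p) (q ^ k)) $ n)" for n
    unfolding colored_gen_poly_eq[OF assms(1) nz[unfolded x_def], folded x_def]
    by (rule nonzero_mult_div_cancel_left)
  then show ?thesis by (simp only: fps2_suminf_powers_u fps2_suminf_powers_t)
qed

end
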